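(* Let $d\ge1$. There exist constants $C>0$ and $n_0$ (depending only on $d$) such that for all integers $n\ge n_0$, $$\overleftarrow{m}_{mon}(\mathbb{T}_n^d,maj)\le\Big(1-\frac{d}{d+2}\Big)n^d+Cn^{d-1}.$$
   Context: The $d$-dimensional torus $\mathbb{T}_n^d$ is the graph with vertex set $[n]^d=\{1,\dots,n\}^d$, where two vertices are adjacent iff they differ in exactly one coordinate $j$ and in that coordinate $x_j-x'_j\equiv\pm1\pmod n$. A configuration assigns each vertex a state active (1) or inactive (0); its size is the number of active vertices. Majority process: in each round, simultaneously, vertex $v$ becomes active if (number of active neighbors of $v$) $+\omega_v/2>\deg(v)/2$ and inactive otherwise (majority of neighbors, keeping its own state in case of a tie). A dynamo is an initial configuration $\omega^{(0)}$ such that from some time on all vertices are active forever; it is monotone if moreover $\omega^{(t+1)}\ge\omega^{(t)}$ coordinatewise for all $t\ge0$. $\overleftarrow{m}_{mon}(G,maj)$ is the minimum size of a monotone dynamo under the majority process on $G$. *)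

theory Defs
  imports Complex_Main "HOL-Library.FuncSet" "HOL-Number_Theory.Cong"
begin

text \<open>A graph is a vertex set together with an adjacency predicate (only its values on the
  vertex set matter).\<close>

type_synonym 'a graph = "'a set \<times> ('a \<Rightarrow> 'a \<Rightarrow> bool)"

abbreviation vertices :: "'a graph \<Rightarrow> 'a set" where
  "vertices G \<equiv> fst G"

definition neighbors :: "'a graph \<Rightarrow> 'a \<Rightarrow> 'a set" where
  "neighbors G v = {u \<in> vertices G. snd G v u}"

definition degree :: "'a graph \<Rightarrow> 'a \<Rightarrow> nat" where
  "degree G v = card (neighbors G v)"

definition torus :: "nat \<Rightarrow> nat \<Rightarrow> (nat \<Rightarrow> nat) graph" where
  "torus d n =
     ({1..d} \<rightarrow>\<^sub>E {1..n},
      \<lambda>x y. \<exists>j\<in>{1..d}. x j \<noteq> y j \<and> (\<forall>i\<in>{1..d} - {j}. x i = y i) \<and>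
        ([int (x j) - int (y j) = 1] (mod int n) \<or> [int (x j) - int (y j) = - 1] (mod int n)))"

definition configurations :: "'a graph \<Rightarrow> ('a \<Rightarrow> nat) set" where
  "configurations G = vertices G \<rightarrow>\<^sub>E {0, 1}"

definition config_size :: "'a graph \<Rightarrow> ('a \<Rightarrow> nat) \<Rightarrow> nat" where
  "config_size G \<omega> = card {v \<in> vertices G. \<omega> v = 1}"

text \<open>A process maps a graph to its (synchronous) one-round update of configurations.\<close>

type_synonym 'a process = "'a graph \<Rightarrow> ('a \<Rightarrow> nat) \<Rightarrow> ('a \<Rightarrow> nat)"

definition maj :: "'a process" where
  "maj G \<omega> = (\<lambda>v\<in>vertices G.
     if real (card {u \<in> neighbors G v. \<omega> u = 1}) + real (\<omega> v) / 2 > real (degree G v) / 2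
     then 1 else 0)"

definition dynamo :: "'a graph \<Rightarrow> 'a process \<Rightarrow> ('a \<Rightarrow> nat) \<Rightarrow> bool" where
  "dynamo G P \<omega> \<longleftrightarrow> \<omega> \<in> configurations G \<and>
     (\<exists>T. \<forall>t\<ge>T. \<forall>v\<in>vertices G. (P G ^^ t) \<omega> v = 1)"

definition monotone_dynamo :: "'a graph \<Rightarrow> 'a process \<Rightarrow> ('a \<Rightarrow> nat) \<Rightarrow> bool" where
  "monotone_dynamo G P \<omega> \<longleftrightarrow> dynamo G P \<omega> \<and>
     (\<forall>t. \<forall>v\<in>vertices G. (P G ^^ t) \<omega> v \<le> (P G ^^ Suc t) \<omega> v)"

definition m_mon :: "'a graph \<Rightarrow> 'a process \<Rightarrow> nat" where
  "m_mon G P = (LEAST k. \<exists>\<omega>. monotone_dynamo G P \<omega> \<and> config_size G \<omega> = k)"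

text \<open>The minimum defining \<open>m_mon G maj\<close> is over a nonempty set: the all-active configuration
  is always a monotone dynamo.\<close>

lemma monotone_dynamo_all_active: "monotone_dynamo G maj (\<lambda>v\<in>vertices G. 1)"
proof -
  let ?one = "\<lambda>v\<in>vertices G. 1 :: nat"
  have "{u \<in> neighbors G v. ?one u = 1} = neighbors G v" for v
    by (auto simp: neighbors_def)
  then have "maj G ?one = ?one"
    by (auto simp: maj_def degree_def fun_eq_iff restrict_def)
  then have "(maj G ^^ t) ?one = ?one" for t
    by (induction t) simp_all
  then show ?thesis
    by (auto simp: monotone_dynamo_def dynamo_def configurations_def simp del: funpow.simps)
qed

lemma m_mon_attained: "\<exists>\<omega>. monotone_dynamo G maj \<omega> \<and> config_size G \<omega> = m_mon G maj"
  unfolding m_mon_def by (rule LeastI_ex) (use monotone_dynamo_all_active in blast)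

end

theory Submission
  imports Defs
begin

text \<open>Call \<open>x\<^sub>1 + \<dots> + x\<^sub>d\<close> the level of \<open>x\<close>. Initially the vertices whose level is \<open>0\<close>
  or \<open>1\<close> modulo \<open>d + 2\<close> are active, together with the boundary of the box \<open>[n]\<^sup>d\<close>, which
  contributes only \<open>O(n\<^bsup>d-1\<^esup>)\<close>. Every active vertex then has at least \<open>d\<close> active neighbours.
  An inactive vertex has level \<open>k + 1\<close> modulo \<open>d + 2\<close> with \<open>1 \<le> k \<le> d\<close>; assign it the
  rank \<open>2 \<Sum> j x\<^sub>j - k\<^sup>2\<close>. Stepping up in direction \<open>j\<close> changes the rank by
  \<open>2j - (2k + 1)\<close>, which is negative for \<open>j \<le> k\<close>; stepping down changes it by
  \<open>(2k - 1) - 2j\<close>, which is negative for \<open>j \<ge> k\<close>. Hence \<open>k + (d - k + 1) = d + 1\<close> of the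
  \<open>2d\<close> neighbours are initially active or of smaller rank, and the vertices become active in the
  order of their rank.\<close>

section \<open>Majority dynamics on a finite graph: a rank criterion for monotone dynamos\<close>

definition indicator_config :: "'a graph \<Rightarrow> 'a set \<Rightarrow> 'a \<Rightarrow> nat" where
  "indicator_config G A = (\<lambda>v\<in>vertices G. if v \<in> A then 1 else 0)"

lemma maj_active_iff:
  assumes "v \<in> vertices G"
  shows "maj G \<omega> v = 1 \<longleftrightarrow> degree G v < 2 * card {u \<in> neighbors G v. \<omega> u = 1} + \<omega> v"
proof -
  have "real (degree G v) / 2 < real (card {u \<in> neighbors G v. \<omega> u = 1}) + real (\<omega> v) / 2
    \<longleftrightarrow> real (degree G v) < real (2 * card {u \<in> neighbors G v. \<omega> u = 1} + \<omega> v)"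
    by (simp add: field_simps)
  then show ?thesis
    using assms by (simp only: maj_def restrict_apply of_nat_less_iff) simp
qed

lemma maj_le_1: "v \<in> vertices G \<Longrightarrow> maj G \<omega> v \<le> 1"
  by (simp add: maj_def)

text \<open>Enlarging the active set can only raise the count of active neighbours and the
  contribution of the vertex's own state; \<open>le1\<close> ensures that an active state stays
  exactly 1. This is what carries growth in the first round over to all later rounds.\<close>

lemma maj_mono:
  assumes fin: "finite (vertices G)"
    and le: "\<And>u. u \<in> vertices G \<Longrightarrow> \<omega> u \<le> \<omega>' u"
    and le1: "\<And>u. u \<in> vertices G \<Longrightarrow> \<omega>' u \<le> 1"
    and v: "v \<in> vertices G"
  shows "maj G \<omega> v \<le> maj G \<omega>' v"
proof (cases "maj G \<omega> v = 1")
  case True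
  have "{u \<in> neighbors G v. \<omega> u = 1} \<subseteq> {u \<in> neighbors G v. \<omega>' u = 1}"
    using le le1 by (fastforce simp: neighbors_def intro: order_antisym)
  then have "card {u \<in> neighbors G v. \<omega> u = 1} \<le> card {u \<in> neighbors G v. \<omega>' u = 1}"
    using fin by (intro card_mono) (auto simp: neighbors_def)
  then have "maj G \<omega>' v = 1"
    using True le[OF v] v by (simp add: maj_active_iff del: One_nat_def)
  then show ?thesis using True by simp
next
  case False
  then have "maj G \<omega> v = 0" using maj_le_1[OF v, of \<omega>] by linarith
  then show ?thesis by simp
qed

text \<open>An active vertex wins ties, so half of its neighbours suffice in \<open>stable\<close>;
  an inactive one needs the strict majority of \<open>growth\<close>. The first condition makes
  round one nondecreasing, and monotonicity of \<open>maj\<close> extends this to every round. The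
  second then activates each vertex by time \<open>rank v + 1\<close>, by induction on the
  rank.\<close>

lemma monotone_dynamo_indicator:
  fixes rank :: "'a \<Rightarrow> nat"
  assumes fin: "finite (vertices G)"
    and stable: "\<And>v. v \<in> vertices G \<Longrightarrow> v \<in> A \<Longrightarrow>
      degree G v \<le> 2 * card {u \<in> neighbors G v. u \<in> A}"
    and growth: "\<And>v. v \<in> vertices G \<Longrightarrow> v \<notin> A \<Longrightarrow>
      degree G v < 2 * card {u \<in> neighbors G v. u \<in> A \<or> rank u < rank v}"
  shows "monotone_dynamo G maj (indicator_config G A)"
proof -
  define \<omega> where "\<omega> t = (maj G ^^ t) (indicator_config G A)" for t
  have \<omega>0: "\<omega> 0 = indicator_config G A" and \<omega>_Suc: "\<omega> (Suc t) = maj G (\<omega> t)" for t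
    by (simp_all add: \<omega>_def)
  have finN: "finite (neighbors G v)" for v
    using fin by (simp add: neighbors_def)
  have le1: "\<omega> t v \<le> 1" if "v \<in> vertices G" for t v
    using that
    by (cases t) (auto simp: \<omega>0 \<omega>_Suc indicator_config_def maj_le_1 simp del: One_nat_def)
  have mono: "\<omega> t v \<le> \<omega> (Suc t) v" if "v \<in> vertices G" for t v
    using that
  proof (induction t arbitrary: v)
    case 0
    show ?case
    proof (cases "v \<in> A")
      case True
      have "{u \<in> neighbors G v. \<omega> 0 u = 1} = {u \<in> neighbors G v. u \<in> A}"
        by (auto simp: \<omega>0 indicator_config_def neighbors_def)
      then have "\<omega> (Suc 0) v = 1"
        using stable[OF 0 True] True 0
        by (simp add: \<omega>_Suc maj_active_iff del: One_nat_def) (simp add: \<omega>0 indicator_config_def)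
      then show ?thesis using le1[OF 0, of 0] by simp
    qed (use 0 in \<open>simp add: \<omega>0 indicator_config_def\<close>)
  next
    case (Suc t)
    show ?case
      unfolding \<omega>_Suc[of "Suc t"] \<omega>_Suc[of t]
      using Suc by (intro maj_mono fin) (simp_all flip: \<omega>_Suc add: le1 del: One_nat_def)
  qed
  have stay: "\<omega> t v = 1" if "v \<in> vertices G" "v \<in> A" for t v
  proof (induction t)
    case 0
    then show ?case using that by (simp add: \<omega>0 indicator_config_def)
  next
    case (Suc t)
    then show ?case using mono[OF that(1), of t] le1[OF that(1), of "Suc t"] by linarith
  qed
  have active: "\<omega> t v = 1" if "v \<in> vertices G" "rank v < t" for t v
    using that
  proof (induction "rank v" arbitrary: v t rule: less_induct)
    case less
    show ?case
    proof (cases "v \<in> A")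
      case False
      obtain t' where t: "t = Suc t'" using less.prems(2) by (cases t) auto
      \<comment> \<open>From \<open>rank v < Suc t'\<close>, a neighbour of smaller rank has rank
        below \<open>t'\<close>, so the induction hypothesis makes it active already at time
        \<open>t'\<close>.\<close>
      have "{u \<in> neighbors G v. u \<in> A \<or> rank u < rank v} \<subseteq> {u \<in> neighbors G v. \<omega> t' u = 1}"
        using less stay t by (auto simp: neighbors_def)
      then have "card {u \<in> neighbors G v. u \<in> A \<or> rank u < rank v}
          \<le> card {u \<in> neighbors G v. \<omega> t' u = 1}"
        using finN by (intro card_mono) auto
      then show ?thesis
        using growth[OF less.prems(1) False] less.prems(1)
        by (simp add: t \<omega>_Suc maj_active_iff del: One_nat_def)
    qed (use less stay in simp)
  qed
  obtain T where T: "\<forall>v\<in>vertices G. rank v < T"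
    using finite_nat_set_iff_bounded[of "rank ` vertices G"] fin by auto
  have "dynamo G maj (indicator_config G A)"
    unfolding dynamo_def
  proof (intro conjI exI[of _ T] allI impI ballI)
    show "indicator_config G A \<in> configurations G"
      by (auto simp: indicator_config_def configurations_def)
    show "(maj G ^^ t) (indicator_config G A) v = 1" if "T \<le> t" "v \<in> vertices G" for t v
      using active[OF that(2), of t] T that by (auto simp: \<omega>_def)
  qed
  then show ?thesis
    using mono unfolding monotone_dynamo_def \<omega>_def by blast
qed

lemma m_mon_le_indicator:
  assumes "monotone_dynamo G P (indicator_config G A)"
  shows "m_mon G P \<le> card (vertices G \<inter> A)"
proof -
  have "{v \<in> vertices G. indicator_config G A v = 1} = vertices G \<inter> A"
    by (auto simp: indicator_config_def)
  then have "config_size G (indicator_config G A) = card (vertices G \<inter> A)"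
    by (simp add: config_size_def)
  then show ?thesis
    unfolding m_mon_def using assms by (intro Least_le) blast
qed

section \<open>Neighbourhoods in the torus\<close>

lemma vertices_torus: "vertices (torus d n) = {1..d} \<rightarrow>\<^sub>E {1..n}"
  by (simp add: torus_def)

lemma finite_vertices_torus: "finite (vertices (torus d n))"
  by (simp add: vertices_torus finite_PiE)

lemma fun_upd_neighbor_torus:
  assumes "x \<in> vertices (torus d n)" "j \<in> {1..d}" "t \<in> {1..n}" "t \<noteq> x j"
    and "[int (x j) - int t = 1] (mod int n) \<or> [int (x j) - int t = - 1] (mod int n)"
  shows "x(j := t) \<in> neighbors (torus d n) x"
proof -
  have "x(j := t) \<in> vertices (torus d n)"
    using assms by (auto simp: vertices_torus PiE_def extensional_def)
  then show ?thesis
    using assms unfolding neighbors_def torus_def by auto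
qed

lemma torus_neighbors_subset:
  assumes "x \<in> vertices (torus d n)"
  shows "neighbors (torus d n) x \<subseteq> (\<Union>j\<in>{1..d}. \<Union>a\<in>{1, -1}.
    (\<lambda>t. x(j := t)) ` {t \<in> {1..n}. [int (x j) - int t = a] (mod int n)})"
proof
  fix y assume y: "y \<in> neighbors (torus d n) x"
  then obtain j where j: "j \<in> {1..d}" "\<forall>i\<in>{1..d} - {j}. x i = y i"
    and c: "[int (x j) - int (y j) = 1] (mod int n) \<or> [int (x j) - int (y j) = - 1] (mod int n)"
    unfolding neighbors_def torus_def by auto
  have yV: "y \<in> {1..d} \<rightarrow>\<^sub>E {1..n}"
    using y by (simp add: neighbors_def vertices_torus)
  have "y = x(j := y j)"
  proof
    fix i show "y i = (x(j := y j)) i"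
      using j yV assms by (cases "i \<in> {1..d}") (auto simp: vertices_torus PiE_def extensional_def)
  qed
  moreover have "y j \<in> {1..n}" using yV j(1) by blast
  ultimately show "y \<in> (\<Union>j\<in>{1..d}. \<Union>a\<in>{1, -1}.
      (\<lambda>t. x(j := t)) ` {t \<in> {1..n}. [int (x j) - int t = a] (mod int n)})"
    using j(1) c by blast
qed

text \<open>Each pair of a direction and a sign contributes at most one neighbour. For small
  \<open>n\<close> the two signs may give the same vertex or none, so only an upper bound is
  claimed; it suffices, since a smaller degree lowers the majority threshold.\<close>

lemma degree_torus_le:
  assumes "x \<in> vertices (torus d n)"
  shows "degree (torus d n) x \<le> 2 * d"
proof -
  let ?D = "\<lambda>j a. {t \<in> {1..n}. [int (x j) - int t = a] (mod int n)}"
  have D: "card (?D j a) \<le> 1" for j a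
  proof -
    have "t = t'" if "t \<in> ?D j a" "t' \<in> ?D j a" for t t'
    proof -
      have "[int (x j) - int t = int (x j) - int t'] (mod int n)"
        using that by (auto intro: cong_trans cong_sym)
      then have dvd: "int n dvd int t' - int t"
        by (simp add: cong_iff_dvd_diff)
      \<comment> \<open>Two values in \<open>{1..n}\<close> differ by less than \<open>n\<close>, so
        the only possible multiple of \<open>n\<close> is 0.\<close>
      have "\<bar>int t' - int t\<bar> < \<bar>int n\<bar>"
        using that by auto
      then have "int t' - int t = 0"
        using dvd_imp_le_int[OF _ dvd] by linarith
      then show ?thesis by simp
    qed
    then show ?thesis by (simp add: card_le_Suc0_iff_eq)
  qed
  have "degree (torus d n) x
      \<le> card (\<Union>j\<in>{1..d}. \<Union>a\<in>{1, -1}. (\<lambda>t. x(j := t)) ` ?D j a)"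
    unfolding degree_def by (intro card_mono torus_neighbors_subset assms) auto
  also have "\<dots> \<le> (\<Sum>j\<in>{1..d}. card (\<Union>a\<in>{1, -1}. (\<lambda>t. x(j := t)) ` ?D j a))"
    by (intro card_UN_le) auto
  also have "\<dots> \<le> (\<Sum>j\<in>{1..d}. 2)"
  proof (rule sum_mono)
    fix j
    have "card (\<Union>a\<in>{1, -1}. (\<lambda>t. x(j := t)) ` ?D j a)
        \<le> (\<Sum>a\<in>{1, -1::int}. card ((\<lambda>t. x(j := t)) ` ?D j a))"
      by (intro card_UN_le) auto
    also have "\<dots> \<le> (\<Sum>a\<in>{1, -1::int}. 1)"
      by (intro sum_mono order_trans[OF card_image_le D]) auto
    finally show "card (\<Union>a\<in>{1, -1}. (\<lambda>t. x(j := t)) ` ?D j a) \<le> 2" by simp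
  qed
  finally show ?thesis by simp
qed

text \<open>The coordinate at which an update differs from \<open>x\<close> reveals its direction.
  This turns lists of directions into lower bounds on numbers of neighbours.\<close>

lemma card_fun_upd_image:
  assumes "\<And>j. j \<in> J \<Longrightarrow> c j \<noteq> x j"
  shows "card ((\<lambda>j. x(j := c j)) ` J) = card J"
proof (rule card_image, rule inj_onI)
  fix i j assume "i \<in> J" "j \<in> J" and eq: "x(i := c i) = x(j := c j)"
  show "i = j"
    using fun_cong[OF eq, of i] assms[OF \<open>i \<in> J\<close>] by (auto split: if_splits)
qed

section \<open>Counting residue classes and the boundary of the box\<close>

text \<open>With the residue fixed, the quotient of \<open>t + c\<close> by \<open>m\<close>
  determines \<open>t\<close>, and these quotients fill at most the interval from
  \<open>c div m\<close> to \<open>(n + c) div m\<close>. The bound is uniform in the offset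
  \<open>c\<close>, which will be the sum of the other coordinates.\<close>

lemma card_residue_class_le:
  fixes m n c r :: nat
  assumes "m > 0"
  shows "real (card {t \<in> {1..n}. (t + c) mod m = r}) \<le> real n / real m + 2"
proof -
  let ?T = "{t \<in> {1..n}. (t + c) mod m = r}"
  have "inj_on (\<lambda>t. (t + c) div m) ?T"
  proof (rule inj_onI)
    fix t u assume "t \<in> ?T" "u \<in> ?T" "(t + c) div m = (u + c) div m"
    then have "t + c = u + c"
      using div_mult_mod_eq[of "t + c" m] div_mult_mod_eq[of "u + c" m] by simp
    then show "t = u" by simp
  qed
  then have "card ?T = card ((\<lambda>t. (t + c) div m) ` ?T)"
    by (simp add: card_image)
  also have "\<dots> \<le> card {c div m..(n + c) div m}"
    by (intro card_mono) (auto intro!: div_le_mono)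
  finally have "card ?T + c div m \<le> Suc ((n + c) div m)"
    using div_le_mono[of c "n + c" m] by simp
  then have "real (card ?T) + real (c div m) \<le> 1 + real ((n + c) div m)"
    by linarith
  moreover have "real ((n + c) div m) \<le> (real n + real c) / real m"
    using of_nat_div_le_of_nat[where 'a = real, of "n + c" m] by simp
  moreover have "real c / real m - 1 \<le> real (c div m)"
    using of_nat_of_nat_div_aux[where 'a = real, of c m] assms by (simp add: field_simps)
  ultimately show ?thesis by (simp add: add_divide_distrib)
qed

text \<open>Once the coordinates in \<open>I\<close> are chosen, coordinate \<open>i\<close> is
  confined to one residue class; summing the uniform one-dimensional bound over all choices gives
  the estimate.\<close>

lemma card_sum_residue_class_le:
  fixes m n r :: nat
  assumes "finite I" "i \<notin> I" "m > 0"
  shows "real (card {x \<in> insert i I \<rightarrow>\<^sub>E {1..n}. (\<Sum>j\<in>insert i I. x j) mod m = r})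
    \<le> (real n / real m + 2) * real n ^ card I"
proof -
  let ?X = "{x \<in> insert i I \<rightarrow>\<^sub>E {1..n}. (\<Sum>j\<in>insert i I. x j) mod m = r}"
  let ?T = "\<lambda>g. {t \<in> {1..n}. (t + sum g I) mod m = r}"
  have "?X \<subseteq> (\<Union>g\<in>I \<rightarrow>\<^sub>E {1..n}. (\<lambda>t. g(i := t)) ` ?T g)"
  proof
    fix x assume x: "x \<in> ?X"
    then obtain t g where xg: "x = g(i := t)" "t \<in> {1..n}" "g \<in> I \<rightarrow>\<^sub>E {1..n}"
      by (auto simp: PiE_insert_eq)
    have "sum x I = sum g I"
      using assms(2) by (intro sum.cong) (auto simp: xg)
    then have "t \<in> ?T g"
      using x assms xg by auto
    then show "x \<in> (\<Union>g\<in>I \<rightarrow>\<^sub>E {1..n}. (\<lambda>t. g(i := t)) ` ?T g)"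
      using xg by blast
  qed
  then have "card ?X \<le> card (\<Union>g\<in>I \<rightarrow>\<^sub>E {1..n}. (\<lambda>t. g(i := t)) ` ?T g)"
    using assms by (intro card_mono finite_UN_I finite_PiE) auto
  also have "\<dots> \<le> (\<Sum>g\<in>I \<rightarrow>\<^sub>E {1..n}. card ((\<lambda>t. g(i := t)) ` ?T g))"
    using assms by (intro card_UN_le finite_PiE) auto
  also have "\<dots> \<le> (\<Sum>g\<in>I \<rightarrow>\<^sub>E {1..n}. card (?T g))"
    by (intro sum_mono card_image_le) auto
  finally have "real (card ?X) \<le> (\<Sum>g\<in>I \<rightarrow>\<^sub>E {1..n}. real (card (?T g)))"
    by (simp flip: of_nat_sum)
  also have "\<dots> \<le> (\<Sum>g\<in>I \<rightarrow>\<^sub>E {1..n}. real n / real m + 2)"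
    using assms(3) by (intro sum_mono card_residue_class_le)
  also have "\<dots> = (real n / real m + 2) * real n ^ card I"
    using assms(1) by (simp add: card_PiE)
  finally show ?thesis .
qed

lemma card_box_boundary_le:
  assumes "finite I"
  shows "card {x \<in> I \<rightarrow>\<^sub>E {1..n}. \<exists>i\<in>I. x i \<in> {1, n}} \<le> card I * (2 * n ^ (card I - 1))"
proof -
  \<comment> \<open>Fixing which coordinate is extremal gives a product set, so a union bound
    reduces the count to \<open>card_PiE\<close>.\<close>
  let ?F = "\<lambda>i. PiE I (\<lambda>j. if j = i then {1, n} else {1..n})"
  have "card {x \<in> I \<rightarrow>\<^sub>E {1..n}. \<exists>i\<in>I. x i \<in> {1, n}} \<le> card (\<Union>i\<in>I. ?F i)"
    using assms by (intro card_mono finite_UN_I finite_PiE) (auto simp: PiE_def Pi_def)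
  also have "\<dots> \<le> (\<Sum>i\<in>I. card (?F i))"
    using assms by (intro card_UN_le)
  also have "\<dots> \<le> (\<Sum>i\<in>I. 2 * n ^ (card I - 1))"
  proof (rule sum_mono)
    fix i assume i: "i \<in> I"
    have "card (?F i) = (\<Prod>j\<in>I. card (if j = i then {1, n} else {1..n}))"
      using assms by (rule card_PiE)
    also have "\<dots> = card {1, n} * (\<Prod>j\<in>I - {i}. card (if j = i then {1, n} else {1..n}))"
      using assms i by (simp add: prod.remove)
    also have "(\<Prod>j\<in>I - {i}. card (if j = i then {1, n} else {1..n})) = (\<Prod>j\<in>I - {i}. n)"
      by (intro prod.cong) auto
    also have "\<dots> = n ^ (card I - 1)"
      using assms i by simp
    also have "card {1, n} * n ^ (card I - 1) \<le> 2 * n ^ (card I - 1)"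
      by (intro mult_right_mono) (auto simp: card_insert_if)
    finally show "card (?F i) \<le> 2 * n ^ (card I - 1)" .
  qed
  also have "\<dots> = card I * (2 * n ^ (card I - 1))" by simp
  finally show ?thesis .
qed

section \<open>Levels, the seed and the activation rank\<close>

definition level :: "nat \<Rightarrow> (nat \<Rightarrow> nat) \<Rightarrow> nat" where
  "level d x = (\<Sum>i\<in>{1..d}. x i)"

definition weight :: "nat \<Rightarrow> (nat \<Rightarrow> nat) \<Rightarrow> nat" where
  "weight d x = (\<Sum>i\<in>{1..d}. i * x i)"

text \<open>The boundary is included to hide the wrap-around, across which the level jumps by
  \<open>n - 1\<close>. Torus vertices outside the seed have an honest step up and down in every
  direction.\<close>

definition seed :: "nat \<Rightarrow> nat \<Rightarrow> (nat \<Rightarrow> nat) set" where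
  "seed d n = {x. level d x mod (d + 2) = 0 \<or> level d x mod (d + 2) = 1 \<or>
    (\<exists>i\<in>{1..d}. x i \<in> {1, n})}"

text \<open>The summand \<open>(d + 1)\<^sup>2\<close> only keeps the value nonnegative; neither subtraction truncates when
  the level is not \<open>0\<close> modulo \<open>d + 2\<close>.\<close>

definition activation_rank :: "nat \<Rightarrow> (nat \<Rightarrow> nat) \<Rightarrow> nat" where
  "activation_rank d x = 2 * weight d x + (d + 1)\<^sup>2 - (level d x mod (d + 2) - 1)\<^sup>2"

text \<open>The additive form serves steps up and down alike and avoids truncated
  subtraction.\<close>

lemma level_fun_upd:
  assumes "j \<in> {1..d}"
  shows "level d (x(j := t)) + x j = level d x + t"
proof -
  have "(\<Sum>i\<in>{1..d} - {j}. (x(j := t)) i) = (\<Sum>i\<in>{1..d} - {j}. x i)"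
    by (intro sum.cong) auto
  then show ?thesis
    using sum.remove[OF _ assms, of x] sum.remove[OF _ assms, of "x(j := t)"]
    by (simp add: level_def)
qed

lemma weight_fun_upd:
  assumes "j \<in> {1..d}"
  shows "weight d (x(j := t)) + j * x j = weight d x + j * t"
proof -
  have "(\<Sum>i\<in>{1..d} - {j}. i * (x(j := t)) i) = (\<Sum>i\<in>{1..d} - {j}. i * x i)"
    by (intro sum.cong) auto
  then show ?thesis
    using sum.remove[OF _ assms, of "\<lambda>i. i * x i"]
      sum.remove[OF _ assms, of "\<lambda>i. i * (x(j := t)) i"]
    by (simp add: weight_def)
qed

text \<open>Since \<open>k \<le> d + 1\<close>, no subtraction truncates; over the integers,
  comparing ranks becomes polynomial arithmetic.\<close>

lemma int_activation_rank:
  assumes "level d x mod (d + 2) = Suc k"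
  shows "int (activation_rank d x) = 2 * int (weight d x) + (int d + 1)\<^sup>2 - (int k)\<^sup>2"
proof -
  have "Suc k < d + 2" using assms by (metis mod_less_divisor zero_less_Suc add_2_eq_Suc')
  then have "k\<^sup>2 \<le> (d + 1)\<^sup>2" by (intro power_mono) auto
  then have "k\<^sup>2 \<le> 2 * weight d x + (d + 1)\<^sup>2" by linarith
  moreover have "activation_rank d x = 2 * weight d x + (d + 1)\<^sup>2 - k\<^sup>2"
    unfolding activation_rank_def assms by simp
  ultimately show ?thesis
    by (simp only: of_nat_diff of_nat_add of_nat_mult of_nat_power) simp
qed

text \<open>For \<open>k = d\<close> the residue wraps to 0, which lies in the seed. Otherwise the
  rank changes by \<open>2 * j - (2 * k + 1)\<close>, which is negative.\<close>

lemma up_seed_or_earlier: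
  assumes k: "level d x mod (d + 2) = Suc k" and j: "j \<in> {1..d}" "j \<le> k"
  shows "x(j := x j + 1) \<in> seed d n \<or> activation_rank d (x(j := x j + 1)) < activation_rank d x"
proof -
  let ?y = "x(j := x j + 1)"
  have l: "level d ?y = Suc (level d x)" using level_fun_upd[OF j(1), of x "x j + 1"] by simp
  have w: "weight d ?y = weight d x + j"
    using weight_fun_upd[OF j(1), of x "x j + 1"] by (simp add: algebra_simps)
  show ?thesis
  proof (cases "k = d")
    case True
    then have "level d ?y mod (d + 2) = 0" using k l by (simp add: mod_Suc)
    then show ?thesis by (simp add: seed_def)
  next
    case False
    then have "level d ?y mod (d + 2) = Suc (Suc k)" using k l by (simp add: mod_Suc)
    from int_activation_rank[OF this] int_activation_rank[OF k] w j(2)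
    have "int (activation_rank d ?y) < int (activation_rank d x)"
      by (simp add: power2_eq_square algebra_simps)
    then show ?thesis by simp
  qed
qed

text \<open>The neighbour has residue \<open>k\<close>, a seed residue when
  \<open>k \<le> 1\<close>. Otherwise the rank changes by \<open>(2 * k - 1) - 2 * j\<close>, which
  is negative.\<close>

lemma down_seed_or_earlier:
  assumes k: "level d x mod (d + 2) = Suc k" and j: "j \<in> {1..d}" "k \<le> j" and pos: "x j > 0"
  shows "x(j := x j - 1) \<in> seed d n \<or> activation_rank d (x(j := x j - 1)) < activation_rank d x"
proof -
  let ?y = "x(j := x j - 1)"
  obtain u where u: "x j = Suc u" using pos gr0_implies_Suc by blast
  have l: "level d x = Suc (level d ?y)" using level_fun_upd[OF j(1), of x u] u by simp
  have w: "weight d x = weight d ?y + j"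
    using weight_fun_upd[OF j(1), of x u] u by (simp add: algebra_simps)
  \<comment> \<open>The residue \<open>Suc k\<close> is nonzero, so the step up from
    \<open>?y\<close> to \<open>x\<close> does not wrap modulo \<open>d + 2\<close>.\<close>
  have r: "level d ?y mod (d + 2) = k"
    using k unfolding l by (simp add: mod_Suc split: if_splits)
  show ?thesis
  proof (cases "k \<le> 1")
    case True
    then have "level d ?y mod (d + 2) = 0 \<or> level d ?y mod (d + 2) = 1" using r by auto
    then show ?thesis unfolding seed_def by blast
  next
    case False
    then obtain k' where k': "k = Suc k'" by (cases k) auto
    from int_activation_rank[OF r[unfolded k']] int_activation_rank[OF k] w j(2) k'
    have "int (activation_rank d ?y) < int (activation_rank d x)"
      by (simp add: power2_eq_square algebra_simps)
    then show ?thesis by simp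
  qed
qed

lemma torus_inner_neighbors:
  assumes "x \<in> vertices (torus d n)" "j \<in> {1..d}" "x j \<notin> {1, n}"
  shows "x(j := x j + 1) \<in> neighbors (torus d n) x" "x(j := x j - 1) \<in> neighbors (torus d n) x"
proof -
  have "x j \<in> {1..n}" using assms by (auto simp: vertices_torus)
  then have *: "1 < x j" "x j < n" using assms(3) by auto
  show "x(j := x j + 1) \<in> neighbors (torus d n) x"
    using assms * by (intro fun_upd_neighbor_torus) auto
  show "x(j := x j - 1) \<in> neighbors (torus d n) x"
    using assms * by (intro fun_upd_neighbor_torus) (auto simp: of_nat_diff)
qed

section \<open>The seed is a monotone dynamo\<close>

text \<open>One seed neighbour per direction suffices. On the boundary, a cyclic shift keeps some
  coordinate in \<open>{1, n}\<close>; in the interior, residue 0 is served by all steps up and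
  residue 1 by all steps down.\<close>

lemma seed_stable:
  assumes x: "x \<in> vertices (torus d n)" and seed: "x \<in> seed d n" and n: "n \<ge> 3"
  shows "d \<le> card {u \<in> neighbors (torus d n) x. u \<in> seed d n}"
proof -
  \<comment> \<open>Each case below only has to supply the new value \<open>c j\<close> for every
    direction.\<close>
  have *: "d \<le> card {u \<in> neighbors (torus d n) x. u \<in> seed d n}"
    if "\<And>j. j \<in> {1..d} \<Longrightarrow> c j \<noteq> x j"
      "\<And>j. j \<in> {1..d} \<Longrightarrow> x(j := c j) \<in> neighbors (torus d n) x \<and> x(j := c j) \<in> seed d n"
    for c
  proof -
    have "finite (neighbors (torus d n) x)"
      using finite_vertices_torus by (simp add: neighbors_def)
    then have "card ((\<lambda>j. x(j := c j)) ` {1..d})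
        \<le> card {u \<in> neighbors (torus d n) x. u \<in> seed d n}"
      using that by (intro card_mono) auto
    then show ?thesis using card_fun_upd_image[of "{1..d}" c x] that(1) by simp
  qed
  have range: "x j \<in> {1..n}" if "j \<in> {1..d}" for j
    using that x by (auto simp: vertices_torus)
  show ?thesis
  proof (cases "\<exists>i\<in>{1..d}. x i \<in> {1, n}")
    case True
    then obtain i where i: "i \<in> {1..d}" "x i \<in> {1, n}" by blast
    \<comment> \<open>A cyclic neighbour of the coordinate, chosen so that \<open>{1, n}\<close> is preserved.\<close>
    define c where "c j = (if x j = 1 then n else if x j = n then 1 else x j + 1)" for j
    show ?thesis
    proof (rule *[of c])
      fix j assume j: "j \<in> {1..d}"
      show c: "c j \<noteq> x j" using n by (auto simp: c_def)
      have "[1 - int n = 1] (mod int n)" "[int n - 1 = - 1] (mod int n)"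
        by (simp_all add: cong_iff_dvd_diff)
      then have "x(j := c j) \<in> neighbors (torus d n) x"
        using x j c range[OF j] n by (intro fun_upd_neighbor_torus) (auto simp: c_def)
      moreover have "(x(j := c j)) i \<in> {1, n}"
        using i by (auto simp: c_def)
      ultimately show "x(j := c j) \<in> neighbors (torus d n) x \<and> x(j := c j) \<in> seed d n"
        unfolding seed_def using i(1) by blast
    qed
  next
    case False
    then have inner: "x j \<notin> {1, n}" if "j \<in> {1..d}" for j using that by blast
    from seed False consider "level d x mod (d + 2) = 0" | "level d x mod (d + 2) = 1"
      unfolding seed_def mem_Collect_eq by metis
    then show ?thesis
    proof cases
      case 1
      have "x(j := x j + 1) \<in> seed d n" if j: "j \<in> {1..d}" for j
      proof -
        have "level d (x(j := x j + 1)) = Suc (level d x)"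
          using level_fun_upd[OF j, of x "x j + 1"] by simp
        then have "level d (x(j := x j + 1)) mod (d + 2) = 1" using 1 by (simp add: mod_Suc)
        then show ?thesis unfolding seed_def by blast
      qed
      then show ?thesis
        using torus_inner_neighbors(1)[OF x _ inner] by (intro *[of "\<lambda>j. x j + 1"]) auto
    next
      case 2
      have "x(j := x j - 1) \<in> seed d n" if j: "j \<in> {1..d}" for j
      proof -
        have "level d x = Suc (level d (x(j := x j - 1)))"
          using level_fun_upd[OF j, of x "x j - 1"] range[OF j] by auto
        then have "level d (x(j := x j - 1)) mod (d + 2) = 0"
          using 2 by (simp add: mod_Suc split: if_splits)
        then show ?thesis unfolding seed_def by blast
      qed
      moreover have "x j - 1 \<noteq> x j" if "j \<in> {1..d}" for j using range[OF that] by auto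
      ultimately show ?thesis
        using torus_inner_neighbors(2)[OF x _ inner] by (intro *[of "\<lambda>j. x j - 1"]) auto
    qed
  qed
qed

lemma seed_growth:
  assumes x: "x \<in> vertices (torus d n)" and seed: "x \<notin> seed d n"
  shows "d < card {u \<in> neighbors (torus d n) x.
    u \<in> seed d n \<or> activation_rank d u < activation_rank d x}"
    (is "_ < card ?N")
proof -
  define k where "k = level d x mod (d + 2) - 1"
  have "level d x mod (d + 2) \<noteq> 0" "level d x mod (d + 2) \<noteq> 1"
    using seed unfolding seed_def mem_Collect_eq by metis+
  moreover have "level d x mod (d + 2) < d + 2" by (rule mod_less_divisor) simp
  ultimately have k: "level d x mod (d + 2) = Suc k" "1 \<le> k" "k \<le> d"
    unfolding k_def by linarith+
  have inner: "x j \<notin> {1, n}" if "j \<in> {1..d}" for j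
    using seed that unfolding seed_def by blast
  have pos: "x j > 0" if "j \<in> {1..d}" for j
    using PiE_mem[OF x[unfolded vertices_torus] that] by simp
  \<comment> \<open>Direction \<open>k\<close> occurs in both families; this overlap provides the
    one neighbour beyond \<open>d\<close>.\<close>
  let ?U = "(\<lambda>j. x(j := x j + 1)) ` {1..k}" and ?D = "(\<lambda>j. x(j := x j - 1)) ` {k..d}"
  have "?U \<subseteq> ?N"
  proof (rule image_subsetI)
    fix j assume "j \<in> {1..k}"
    then have j: "j \<in> {1..d}" "j \<le> k" using k by auto
    show "x(j := x j + 1) \<in> ?N"
      using torus_inner_neighbors(1)[OF x j(1) inner[OF j(1)]] up_seed_or_earlier[OF k(1) j, of n]
      by blast
  qed
  moreover have "?D \<subseteq> ?N"
  proof (rule image_subsetI)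
    fix j assume "j \<in> {k..d}"
    then have j: "j \<in> {1..d}" "k \<le> j" using k by auto
    show "x(j := x j - 1) \<in> ?N"
      using torus_inner_neighbors(2)[OF x j(1) inner[OF j(1)]]
        down_seed_or_earlier[OF k(1) j pos[OF j(1)], of n]
      by blast
  qed
  moreover have "finite ?N"
    using finite_vertices_torus by (simp add: neighbors_def)
  ultimately have "card (?U \<union> ?D) \<le> card ?N"
    by (intro card_mono) auto
  moreover have "?U \<inter> ?D = {}"
  proof -
    \<comment> \<open>A step up exceeds \<open>x\<close> at \<open>i\<close>, whereas a step down
      exceeds \<open>x\<close> nowhere.\<close>
    have "x(i := x i + 1) \<noteq> x(j := x j - 1)" for i j
    proof
      assume eq: "x(i := x i + 1) = x(j := x j - 1)"
      show False using fun_cong[OF eq, of i] by (auto split: if_splits)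
    qed
    then show ?thesis by blast
  qed
  moreover have "card ?U = k"
    using card_fun_upd_image[of "{1..k}" "\<lambda>j. x j + 1" x] by simp
  moreover have "x j - 1 \<noteq> x j" if "j \<in> {k..d}" for j
    using pos[of j] that k by auto
  then have "card ?D = Suc d - k"
    using card_fun_upd_image[of "{k..d}" "\<lambda>j. x j - 1" x] by simp
  ultimately show ?thesis
    using k by (simp add: card_Un_disjoint)
qed

lemma monotone_dynamo_seed:
  assumes "n \<ge> 3"
  shows "monotone_dynamo (torus d n) maj (indicator_config (torus d n) (seed d n))"
proof (rule monotone_dynamo_indicator[where rank = "activation_rank d"])
  show "finite (vertices (torus d n))" by (rule finite_vertices_torus)
  show "degree (torus d n) x \<le> 2 * card {u \<in> neighbors (torus d n) x. u \<in> seed d n}"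
    if "x \<in> vertices (torus d n)" "x \<in> seed d n" for x
    using degree_torus_le[OF that(1)] seed_stable[OF that assms] by linarith
  show "degree (torus d n) x < 2 * card {u \<in> neighbors (torus d n) x.
      u \<in> seed d n \<or> activation_rank d u < activation_rank d x}"
    if "x \<in> vertices (torus d n)" "x \<notin> seed d n" for x
    using degree_torus_le[OF that(1)] seed_growth[OF that] by linarith
qed

section \<open>Size of the seed and the final bound\<close>

text \<open>Each of the two residue classes has density \<open>1 / (d + 2)\<close> with error at
  most \<open>2 * n ^ (d - 1)\<close>; the boundary adds at most \<open>2 * d * n ^ (d - 1)\<close>.
  The error coefficients total \<open>2 * d + 4\<close>.\<close>

lemma card_seed_le:
  assumes "d \<ge> 1"
  shows "real (card (vertices (torus d n) \<inter> seed d n))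
    \<le> 2 / (real d + 2) * real n ^ d + (2 * real d + 4) * real n ^ (d - 1)"
proof -
  let ?L = "\<lambda>r. {x \<in> {1..d} \<rightarrow>\<^sub>E {1..n}. level d x mod (d + 2) = r}"
  let ?B = "{x \<in> {1..d} \<rightarrow>\<^sub>E {1..n}. \<exists>i\<in>{1..d}. x i \<in> {1, n}}"
  \<comment> \<open>Coordinate 1 is the one confined by the residue condition; the other
    \<open>d - 1\<close> range freely.\<close>
  have ins: "{1..d} = insert 1 {2..d}" using assms by auto
  have L: "real (card (?L r)) \<le> (real n / (real d + 2) + 2) * real n ^ (d - 1)" for r
    using card_sum_residue_class_le[of "{2..d}" 1 "d + 2" n r] unfolding level_def ins
    by (simp add: add.commute)
  have "card ?B \<le> d * (2 * n ^ (d - 1))"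
    using card_box_boundary_le[of "{1..d}" n] by simp
  then have "real (card ?B) \<le> real (d * (2 * n ^ (d - 1)))"
    by (simp only: of_nat_le_iff)
  then have B: "real (card ?B) \<le> 2 * real d * real n ^ (d - 1)" by simp
  have "vertices (torus d n) \<inter> seed d n = ?L 0 \<union> ?L 1 \<union> ?B"
    unfolding seed_def vertices_torus by blast
  then have "card (vertices (torus d n) \<inter> seed d n) \<le> card (?L 0) + card (?L 1) + card ?B"
    by (metis (lifting) add_right_mono card_Un_le order_trans)
  then have "real (card (vertices (torus d n) \<inter> seed d n))
      \<le> real (card (?L 0)) + real (card (?L 1)) + real (card ?B)"
    by (simp flip: of_nat_add)
  also have "\<dots> \<le> 2 * ((real n / (real d + 2) + 2) * real n ^ (d - 1))
      + 2 * real d * real n ^ (d - 1)"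
    unfolding mult_2[of "_ * real n ^ (d - 1)"] by (intro add_mono L B)
  also have "\<dots> = 2 / (real d + 2) * (real n * real n ^ (d - 1))
      + (2 * real d + 4) * real n ^ (d - 1)"
    by (simp add: algebra_simps)
  also have "real n * real n ^ (d - 1) = real n ^ d"
    using assms by (cases d) auto
  finally show ?thesis .
qed

theorem theorem7:
  fixes d :: nat
  assumes "d \<ge> 1"
  shows "\<exists>C::real. C > 0 \<and> (\<exists>n\<^sub>0::nat. \<forall>n\<ge>n\<^sub>0.
           real (m_mon (torus d n) maj)
             \<le> (1 - real d / (real d + 2)) * real n ^ d + C * real n ^ (d - 1))"
proof (intro exI[of _ "2 * real d + 4"] exI[of _ 3] conjI allI impI)
  fix n :: nat assume "n \<ge> 3"
  \<comment> \<open>The leading coefficient is the density of two residue classes out of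
    \<open>d + 2\<close>. The constant is the error coefficient of \<open>card_seed_le\<close>, and
    the threshold 3 is that of \<open>monotone_dynamo_seed\<close>.\<close>
  have "1 - real d / (real d + 2) = 2 / (real d + 2)"
    by (simp add: field_simps)
  moreover have "real (m_mon (torus d n) maj) \<le> real (card (vertices (torus d n) \<inter> seed d n))"
    using m_mon_le_indicator[OF monotone_dynamo_seed[OF \<open>n \<ge> 3\<close>]] by simp
  ultimately show "real (m_mon (torus d n) maj)
      \<le> (1 - real d / (real d + 2)) * real n ^ d + (2 * real d + 4) * real n ^ (d - 1)"
    using card_seed_le[OF assms, of n] by simp
qed simp

end
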